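(* Let $I\subseteq\mathbb{R}$ be an interval, let $f,g:I\to[0,\infty)$ be Nesbitt-convex and similarly ordered functions, and let $a,b\in I$ with $a<b$. Then $$\frac{1}{b-a}\int_a^b f(x)g(x)\,dx\le\left(5-\frac{30}{8}\ln 3\right)\bigl(f(a)g(a)+f(b)g(b)\bigr).$$
   Context: Definition (Nesbitt-convex function). Let $I\subseteq\mathbb{R}$ be a nonempty interval. A function $f:I\to[0,\infty)$ is called Nesbitt-convex if $$f(tx+(1-t)y)\le\left(\frac{2t^2}{3-2t}+\frac{2t(1-t)}{1+2t}\right)f(x)+\left(\frac{2t(1-t)}{3-2t}+\frac{2(1-t)^2}{1+2t}\right)f(y)$$ for all $x,y\in I$ and all $t\in(0,1]$. Two functions $f,g:I\to\mathbb{R}$ are similarly ordered if $(f(x)-f(y))(g(x)-g(y))\ge0$ for all $x,y\in I$. *)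

theory Defs
  imports "HOL-Analysis.Analysis"
begin

(* Functions on I are total functions on the reals of which only the values on I matter. *)

definition nesbitt_convex_on :: "real set \<Rightarrow> (real \<Rightarrow> real) \<Rightarrow> bool" where
  "nesbitt_convex_on I f \<longleftrightarrow>
     is_interval I \<and> I \<noteq> {} \<and> (\<forall>x\<in>I. 0 \<le> f x) \<and>
     (\<forall>x\<in>I. \<forall>y\<in>I. \<forall>t\<in>{0<..1}.
        f (t * x + (1 - t) * y) \<le>
          (2 * t^2 / (3 - 2 * t) + 2 * t * (1 - t) / (1 + 2 * t)) * f x +
          (2 * t * (1 - t) / (3 - 2 * t) + 2 * (1 - t)^2 / (1 + 2 * t)) * f y)"

definition similarly_ordered_on :: "real set \<Rightarrow> (real \<Rightarrow> real) \<Rightarrow> (real \<Rightarrow> real) \<Rightarrow> bool" where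
  "similarly_ordered_on I f g \<longleftrightarrow> (\<forall>x\<in>I. \<forall>y\<in>I. 0 \<le> (f x - f y) * (g x - g y))"

end

theory Submission
  imports Defs
begin

text \<open>At \<open>t = 1/2\<close> the two coefficients in the Nesbitt inequality are both \<open>1/2\<close>, and all of them
  are at most 2. So a Nesbitt-convex function is midpoint convex and bounded on segments, hence
  convex in the ordinary sense. The product of two similarly ordered nonnegative convex functions is
  convex, and the Hermite--Hadamard inequality gives the constant \<open>1/2\<close>, which is smaller than
  \<open>5 - 30/8 * ln 3\<close>, about 0.88.\<close>

text \<open>The supremum \<open>M\<close> is finite because \<open>h\<close> is bounded above.
  Midpoint convexity halves any upper bound, so \<open>M \<le> M / 2\<close>, which forces
  \<open>M \<le> 0\<close>.\<close>

lemma midpoint_convex_unit_interval_nonpos: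
  fixes h :: "real \<Rightarrow> real"
  assumes mid: "\<And>s t. s \<in> {0..1} \<Longrightarrow> t \<in> {0..1} \<Longrightarrow> h ((s + t) / 2) \<le> (h s + h t) / 2"
    and ends: "h 0 \<le> 0" "h 1 \<le> 0"
    and bdd: "bdd_above (h ` {0..1})" and t: "t \<in> {0..1}"
  shows "h t \<le> 0"
proof -
  define M where "M = Sup (h ` {0..1})"
  have le_M: "h s \<le> M" if "s \<in> {0..1}" for s
    unfolding M_def using bdd that by (auto intro: cSup_upper)
  \<comment> \<open>\<open>s\<close> is the midpoint of an endpoint, where \<open>h \<le> 0\<close>, and another point of the interval.\<close>
  have "h s \<le> M / 2" if s: "s \<in> {0..1}" for s
  proof (cases "s \<le> 1 / 2")
    case True
    then show ?thesis
      using mid[of 0 "2 * s"] ends le_M[of "2 * s"] s by auto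
  next
    case False
    then show ?thesis
      using mid[of "2 * s - 1" 1] ends le_M[of "2 * s - 1"] s by auto
  qed
  then have "M \<le> M / 2"
    unfolding M_def by (intro cSup_least) auto
  then show ?thesis
    using le_M[OF t] by linarith
qed

text \<open>Restrict \<open>f\<close> to a segment and subtract its chord: the difference
  \<open>h\<close> stays midpoint convex and bounded above, and it vanishes at both ends, so it is
  nonpositive.\<close>

lemma convex_on_if_midpoint_convex:
  fixes f :: "'a::real_vector \<Rightarrow> real"
  assumes S: "convex S"
    and mid: "\<And>x y. x \<in> S \<Longrightarrow> y \<in> S \<Longrightarrow> f ((1 / 2) *\<^sub>R (x + y)) \<le> (f x + f y) / 2"
    and bdd: "\<And>x y. x \<in> S \<Longrightarrow> y \<in> S \<Longrightarrow> bdd_above (f ` closed_segment x y)"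
  shows "convex_on S f"
proof (rule convex_onI[OF _ S])
  fix t :: real and x y
  assume t: "0 < t" "t < 1" and xy: "x \<in> S" "y \<in> S"
  define p where "p s = (1 - s) *\<^sub>R x + s *\<^sub>R y" for s
  define h where "h s = f (p s) - ((1 - s) * f x + s * f y)" for s
  have p: "p s \<in> S" if "s \<in> {0..1}" for s
    using that S xy by (auto simp: p_def convex_alt)
  have p_mid: "p ((s + r) / 2) = (1 / 2) *\<^sub>R (p s + p r)" for s r
    by (simp add: p_def algebra_simps add_divide_distrib flip: scaleR_add_left)
  obtain K where K: "\<And>z. z \<in> closed_segment x y \<Longrightarrow> f z \<le> K"
    using bdd[OF xy] by (auto simp: bdd_above_def)
  have "h t \<le> 0"
  proof (rule midpoint_convex_unit_interval_nonpos[where h = h])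
    show "h ((s + r) / 2) \<le> (h s + h r) / 2" if "s \<in> {0..1}" "r \<in> {0..1}" for s r
      using mid[OF p[OF that(1)] p[OF that(2)]] unfolding h_def p_mid
      by (simp add: field_simps)
    show "bdd_above (h ` {0..1})"
    proof (rule bdd_aboveI2)
      fix s :: real assume s: "s \<in> {0..1}"
      \<comment> \<open>\<open>f\<close> may take either sign here, so the chord is bounded through
        absolute values.\<close>
      have scale: "r * (- c) \<le> \<bar>c\<bar>" if "0 \<le> r" "r \<le> 1" for r c :: real
      proof -
        have "r * (- c) \<le> r * \<bar>c\<bar>"
          using that by (intro mult_left_mono) auto
        also have "\<dots> \<le> \<bar>c\<bar>"
          using that by (intro mult_left_le_one_le) auto
        finally show ?thesis .
      qed
      have "(1 - s) * (- f x) + s * (- f y) \<le> \<bar>f x\<bar> + \<bar>f y\<bar>"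
        using s by (intro add_mono scale) auto
      moreover have "f (p s) \<le> K"
        using s by (intro K) (auto simp: p_def closed_segment_def)
      ultimately show "h s \<le> K + \<bar>f x\<bar> + \<bar>f y\<bar>"
        unfolding h_def by simp
    qed
  qed (use t in \<open>auto simp: h_def p_def\<close>)
  then show "f ((1 - t) *\<^sub>R x + t *\<^sub>R y) \<le> (1 - t) * f x + t * f y"
    by (simp add: h_def p_def)
qed

lemma nesbitt_convex_on_imp_convex_on:
  assumes "nesbitt_convex_on I f"
  shows "convex_on I f"
proof (rule convex_on_if_midpoint_convex)
  have nonneg: "\<And>x. x \<in> I \<Longrightarrow> 0 \<le> f x"
    and ineq: "\<And>x y t. x \<in> I \<Longrightarrow> y \<in> I \<Longrightarrow> t \<in> {0<..1} \<Longrightarrow>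
        f (t * x + (1 - t) * y) \<le>
          (2 * t^2 / (3 - 2 * t) + 2 * t * (1 - t) / (1 + 2 * t)) * f x +
          (2 * t * (1 - t) / (3 - 2 * t) + 2 * (1 - t)^2 / (1 + 2 * t)) * f y"
    using assms by (auto simp: nesbitt_convex_on_def)
  show "convex I"
    using assms by (auto simp: nesbitt_convex_on_def is_interval_convex)
  fix x y assume xy: "x \<in> I" "y \<in> I"
  show "f ((1 / 2) *\<^sub>R (x + y)) \<le> (f x + f y) / 2"
    using ineq[OF xy, of "1 / 2"] by (simp add: field_simps power2_eq_square)
  have "f (t * x + (1 - t) * y) \<le> 2 * f x + 2 * f y" if t: "0 \<le> t" "t \<le> 1" for t
  proof (cases "t = 0")
    \<comment> \<open>The Nesbitt inequality excludes \<open>t = 0\<close>; the left side is then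
      \<open>f y\<close>.\<close>
    case True
    then show ?thesis using nonneg xy by simp
  next
    case False
    \<comment> \<open>Both denominators are at least 1 on the unit interval. Dropping them leaves
      \<open>2 * t\<close> and \<open>2 * (1 - t)\<close> as the two coefficients.\<close>
    have div: "u / w \<le> u" if "0 \<le> u" "1 \<le> w" for u w :: real
      using that by (simp add: divide_le_eq mult_le_cancel_left1)
    have "2 * t^2 / (3 - 2 * t) + 2 * t * (1 - t) / (1 + 2 * t) \<le> 2 * t^2 + 2 * t * (1 - t)"
      using t by (intro add_mono div) auto
    also have "\<dots> \<le> 2"
      using t by (simp add: power2_eq_square algebra_simps)
    finally have 1: "2 * t^2 / (3 - 2 * t) + 2 * t * (1 - t) / (1 + 2 * t) \<le> 2" .
    have "2 * t * (1 - t) / (3 - 2 * t) + 2 * (1 - t)^2 / (1 + 2 * t) \<le> 2 * t * (1 - t) + 2 * (1 - t)^2"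
      using t by (intro add_mono div) auto
    also have "\<dots> \<le> 2"
      using t by (simp add: power2_eq_square algebra_simps)
    finally have 2: "2 * t * (1 - t) / (3 - 2 * t) + 2 * (1 - t)^2 / (1 + 2 * t) \<le> 2" .
    have "t \<in> {0<..1}"
      using t False by simp
    from ineq[OF xy this] show ?thesis
      by (rule order_trans) (intro add_mono mult_right_mono 1 2 nonneg xy)
  qed
  then have "f z \<le> 2 * f x + 2 * f y" if "z \<in> closed_segment y x" for z
    using that by (auto simp: closed_segment_def add.commute)
  then show "bdd_above (f ` closed_segment x y)"
    unfolding closed_segment_commute[of x y] by (rule bdd_aboveI2)
qed

text \<open>Nonnegativity lets the two convexity inequalities be multiplied. The resulting product
  differs from the convex combination of the products by
  \<open>t * (1 - t) * ((f x - f y) * (g x - g y))\<close>, whose sign is given by similar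
  ordering.\<close>

lemma convex_on_mult_similarly_ordered:
  fixes f g :: "real \<Rightarrow> real"
  assumes f: "convex_on S f" and g: "convex_on S g"
    and nonneg: "\<And>x. x \<in> S \<Longrightarrow> 0 \<le> f x" "\<And>x. x \<in> S \<Longrightarrow> 0 \<le> g x"
    and so: "similarly_ordered_on S f g"
  shows "convex_on S (\<lambda>x. f x * g x)"
proof (rule convex_onI)
  show S: "convex S" using f by (rule convex_on_imp_convex)
  fix t x y :: real
  assume t: "0 < t" "t < 1" and xy: "x \<in> S" "y \<in> S"
  let ?z = "(1 - t) *\<^sub>R x + t *\<^sub>R y"
  have z: "?z \<in> S"
    using S xy t by (auto simp: convex_alt)
  have "f ?z * g ?z \<le> ((1 - t) * f x + t * f y) * ((1 - t) * g x + t * g y)"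
    using t nonneg xy z convex_onD[OF f _ _ xy, of t] convex_onD[OF g _ _ xy, of t]
    by (intro mult_mono) auto
  also have "\<dots> = (1 - t) * (f x * g x) + t * (f y * g y)
      - t * (1 - t) * ((f x - f y) * (g x - g y))"
    by (simp add: algebra_simps)
  also have "\<dots> \<le> (1 - t) * (f x * g x) + t * (f y * g y)"
    using t so xy by (simp add: similarly_ordered_on_def)
  finally show "f ?z * g ?z \<le> (1 - t) * (f x * g x) + t * (f y * g y)" .
qed

lemma convex_on_Icc_le_chord:
  fixes h :: "real \<Rightarrow> real"
  assumes h: "convex_on {a..b} h" and "a < b" and x: "x \<in> {a..b}"
  shows "h x \<le> h a + (h b - h a) / (b - a) * (x - a)"
  using convex_onD_Icc'[OF h x] assms(2) by (simp add: algebra_simps)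

text \<open>Convexity gives continuity only in the interior, where \<open>h\<close> is thus
  measurable; with a bound it is integrable there, and the endpoints form a null set.\<close>

lemma convex_on_Icc_integrable:
  fixes h :: "real \<Rightarrow> real"
  assumes h: "convex_on {a..b} h"
  shows "h integrable_on {a..b}"
proof (cases "a < b")
  case True
  define K where "K = \<bar>h a\<bar> + \<bar>h b\<bar>"
  define m where "m = (a + b) / 2"
  have upper: "h x \<le> K" if x: "x \<in> {a..b}" for x
  proof -
    have "h x \<le> max (h a) (h b)"
      using convex_on_le_max[OF h] x by simp
    then show ?thesis by (auto simp: K_def)
  qed
  \<comment> \<open>Reflect \<open>x\<close> in the midpoint \<open>m\<close>: an upper bound at
    \<open>a + b - x\<close> and the value at \<open>m\<close> bound \<open>h x\<close> from
    below.\<close>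
  have lower: "2 * h m - K \<le> h x" if x: "x \<in> {a..b}" for x
  proof -
    have "h m \<le> (h x + h (a + b - x)) / 2"
      using convex_onD[OF h, of "1 / 2" x "a + b - x"] x by (simp add: m_def field_simps)
    then show ?thesis
      using upper[of "a + b - x"] x by simp
  qed
  have "h integrable_on {a<..<b}"
  proof (rule measurable_bounded_by_integrable_imp_integrable)
    have "continuous_on {a<..<b} h"
      using h by (intro convex_on_continuous convex_on_subset[OF h]) auto
    then show "h \<in> borel_measurable (lebesgue_on {a<..<b})"
      by (intro continuous_imp_measurable_on_sets_lebesgue) auto
    show "(\<lambda>x. K + 2 * \<bar>h m\<bar>) integrable_on {a<..<b}"
      unfolding integrable_on_open_interval_real by (rule integrable_const_ivl)
    show "norm (h x) \<le> K + 2 * \<bar>h m\<bar>" if "x \<in> {a<..<b}" for x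
      using upper[of x] lower[of x] that by auto
  qed auto
  then show ?thesis
    by (simp add: integrable_on_open_interval_real)
next
  case False
  then show ?thesis
    using integrable_on_empty integrable_on_refl[of h a] by (cases "a = b") auto
qed

text \<open>The right side is the area of the trapezoid under the chord, and the graph lies below
  the chord.\<close>

lemma Hermite_Hadamard_upper:
  fixes h :: "real \<Rightarrow> real"
  assumes h: "convex_on {a..b} h" and ab: "a < b"
  shows "integral {a..b} h \<le> (b - a) * (h a + h b) / 2"
proof -
  define s where "s = (h b - h a) / (b - a)"
  \<comment> \<open>An antiderivative of the chord.\<close>
  define F where "F x = h a * x + s * (x - a)^2 / 2" for x
  have "((\<lambda>x. h a + s * (x - a)) has_integral (F b - F a)) {a..b}"
    using ab by (intro fundamental_theorem_of_calculus)
      (auto simp: F_def has_real_derivative_iff_has_vector_derivative[symmetric]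
        intro!: derivative_eq_intros)
  moreover have "F b - F a = (b - a) * (h a + h b) / 2"
    using ab by (simp add: F_def s_def power2_eq_square field_simps)
  ultimately have chord: "((\<lambda>x. h a + s * (x - a)) has_integral ((b - a) * (h a + h b) / 2)) {a..b}"
    by simp
  show ?thesis
    using convex_on_Icc_integrable[OF h] convex_on_Icc_le_chord[OF h ab]
    by (intro has_integral_le[OF integrable_integral chord]) (auto simp: s_def)
qed

text \<open>The bound \<open>6 / 5\<close> is the value at which \<open>5 - 30 / 8 * ln 3\<close>
  would equal \<open>1 / 2\<close>. The estimate \<open>1 + x \<le> exp x\<close> is too weak at
  \<open>6 / 5\<close> itself, so it is applied at an eighth of it.\<close>

lemma ln_3_le: "ln (3::real) \<le> 6 / 5"
proof -
  have "(3::real) \<le> (1 + 3 / 20) ^ 8"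
    by (simp add: power_divide)
  also have "\<dots> \<le> exp (3 / 20) ^ 8"
    by (intro power_mono exp_ge_add_one_self) auto
  also have "\<dots> = exp (6 / 5)"
    by (simp flip: exp_of_nat_mult)
  finally show ?thesis
    using ln_le_cancel_iff[of 3 "exp (6 / 5)"] by simp
qed

theorem theorem8:
  fixes I :: "real set" and f g :: "real \<Rightarrow> real" and a b :: real
  assumes "is_interval I"
    and "nesbitt_convex_on I f"
    and "nesbitt_convex_on I g"
    and "similarly_ordered_on I f g"
    and "a \<in> I" and "b \<in> I" and "a < b"
  shows "(\<lambda>x. f x * g x) integrable_on {a..b} \<and>
    1 / (b - a) * integral {a..b} (\<lambda>x. f x * g x)
      \<le> (5 - 30 / 8 * ln 3) * (f a * g a + f b * g b)"
proof
  have nonneg: "\<And>x. x \<in> I \<Longrightarrow> 0 \<le> f x" "\<And>x. x \<in> I \<Longrightarrow> 0 \<le> g x"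
    using assms(2,3) by (auto simp: nesbitt_convex_on_def)
  have "convex_on I (\<lambda>x. f x * g x)"
    using assms nonneg by (intro convex_on_mult_similarly_ordered nesbitt_convex_on_imp_convex_on)
  moreover have "{a..b} \<subseteq> I"
    using assms(1,5,6) by (meson atLeastAtMost_iff mem_is_interval_1_I subsetI)
  ultimately have conv: "convex_on {a..b} (\<lambda>x. f x * g x)"
    by (meson convex_on_subset convex_real_interval(5))
  \<comment> \<open>\<open>integral\<close> has the default value 0 on non-integrable functions, so
    this ensures that the bound concerns a genuine integral.\<close>
  then show "(\<lambda>x. f x * g x) integrable_on {a..b}"
    by (rule convex_on_Icc_integrable)
  have "1 / (b - a) * integral {a..b} (\<lambda>x. f x * g x) \<le> 1 / 2 * (f a * g a + f b * g b)"
    using Hermite_Hadamard_upper[OF conv] assms(7) by (simp add: field_simps)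
  \<comment> \<open>The constants compare by \<open>ln_3_le\<close>, and the common factor is
    nonnegative.\<close>
  also have "\<dots> \<le> (5 - 30 / 8 * ln 3) * (f a * g a + f b * g b)"
    using ln_3_le nonneg assms(5,6) by (intro mult_right_mono) auto
  finally show "1 / (b - a) * integral {a..b} (\<lambda>x. f x * g x)
      \<le> (5 - 30 / 8 * ln 3) * (f a * g a + f b * g b)" .
qed

end
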